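(* Let $P,Q$ be integers and let $(U_n(P,Q))_{n\ge 0}$ be the Lucas sequence of the first type. Suppose $P$, $Q$ and $n$ are odd. If either $n \equiv 3 \pmod 6$ and $Q \equiv 3 \pmod 4$, or $n \equiv 5 \pmod 6$ and $Q \equiv 1 \pmod 4$, then $U_n(P,Q)$ is not a non-zero perfect square, i.e. there is no nonzero integer $m$ with $U_n(P,Q)=m^2$.
   Context: For fixed integers $P,Q$, the Lucas sequence of the first type is defined by $U_0(P,Q)=0$, $U_1(P,Q)=1$, and $U_n(P,Q)=P\cdot U_{n-1}(P,Q)-Q\cdot U_{n-2}(P,Q)$ for $n\ge 2$. *)

theory Defs
  imports "HOL-Number_Theory.Cong"
begin

fun lucas_U :: "int \<Rightarrow> int \<Rightarrow> nat \<Rightarrow> int" where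
  "lucas_U P Q 0 = 0"
| "lucas_U P Q (Suc 0) = 1"
| "lucas_U P Q (Suc (Suc n)) = P * lucas_U P Q (Suc n) - Q * lucas_U P Q n"

end

theory Submission
  imports Defs
begin

text \<open>For odd \<open>P\<close> and \<open>Q\<close> the sequence has period 6 modulo 4. As
  \<open>U\<^sub>3 = P\<^sup>2 - Q\<close> and \<open>U\<^sub>5 = P\<^sup>4 - 3P\<^sup>2Q + Q\<^sup>2\<close>, the two cases give
  \<open>U\<^sub>n \<equiv> 2\<close> and \<open>U\<^sub>n \<equiv> 3\<close> modulo 4, neither of which is a quadratic residue.\<close>

text \<open>This is the addition formula
  \<open>U (n + m) = U m * U (n + 1) - Q * U (m - 1) * U n\<close> at \<open>m = 6\<close>, with
  \<open>U 6\<close> in factored form so that its divisibility by 4 becomes visible.\<close>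

lemma lucas_U_add_6:
  "lucas_U P Q (n + 6) = P * (P\<^sup>2 - Q) * (P\<^sup>2 - 3 * Q) * lucas_U P Q (Suc n)
     - Q * (P ^ 4 - 3 * P\<^sup>2 * Q + Q\<^sup>2) * lucas_U P Q n"
  by (simp add: numeral_eq_Suc algebra_simps)

lemma lucas_U_3: "lucas_U P Q 3 = P\<^sup>2 - Q"
  by (simp add: numeral_eq_Suc)

lemma lucas_U_5: "lucas_U P Q 5 = P ^ 4 - 3 * P\<^sup>2 * Q + Q\<^sup>2"
  by (simp add: numeral_eq_Suc algebra_simps)

lemma power2_cong_1_mod_4:
  fixes x :: int
  assumes "odd x"
  shows "[x\<^sup>2 = 1] (mod 4)"
proof -
  obtain k where "x = 2 * k + 1"
    using assms by (elim oddE)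
  then have "x\<^sup>2 - 1 = 4 * (k\<^sup>2 + k)"
    by (simp add: power2_eq_square algebra_simps)
  then show ?thesis
    by (simp add: cong_iff_dvd_diff)
qed

text \<open>For odd \<open>P\<close> and \<open>Q\<close> both \<open>P\<^sup>2 - Q\<close> and
  \<open>P\<^sup>2 - 3 * Q\<close> are even, so 4 divides \<open>U 6\<close>; moreover
  \<open>- Q * U 5\<close> is 1 modulo 4.\<close>

lemma lucas_U_period_6_mod_4:
  assumes "odd P" and "odd Q"
  shows "[lucas_U P Q (n + 6) = lucas_U P Q n] (mod 4)"
proof -
  obtain p where p: "P\<^sup>2 = 1 + 4 * p"
    using power2_cong_1_mod_4[OF assms(1)] by (metis cong_iff_lin cong_sym)
  obtain q where q: "Q = 2 * q + 1"
    using assms(2) by (elim oddE)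
  have P4: "P ^ 4 = (1 + 4 * p)\<^sup>2"
    by (simp flip: p)
  \<comment> \<open>The first summand comes from \<open>P\<^sup>2 - Q = 2 * (2 * p - q)\<close> and
    \<open>P\<^sup>2 - 3 * Q = 2 * (2 * p - 3 * q - 1)\<close>; the factor of
    \<open>lucas_U P Q n\<close> in the second is \<open>(- Q * U 5 - 1) / 4\<close>.\<close>
  have "lucas_U P Q (n + 6) - lucas_U P Q n =
    4 * (P * (2 * p - q) * (2 * p - 3 * q - 1) * lucas_U P Q (Suc n)
      + (- Q * (4 * p\<^sup>2 + 2 * p - 3 * p * Q) + q - 2 * q ^ 3) * lucas_U P Q n)"
    unfolding lucas_U_add_6 P4 p q by (simp add: algebra_simps power2_eq_square power3_eq_cube)
  then show ?thesis
    by (simp add: cong_iff_dvd_diff)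
qed

lemma lucas_U_add_6_mult_mod_4:
  assumes "odd P" and "odd Q"
  shows "[lucas_U P Q (n + 6 * k) = lucas_U P Q n] (mod 4)"
proof (induction k)
  case (Suc k)
  have "[lucas_U P Q (n + 6 * k + 6) = lucas_U P Q (n + 6 * k)] (mod 4)"
    using assms by (rule lucas_U_period_6_mod_4)
  with Suc show ?case
    by (auto simp: algebra_simps intro: cong_trans)
qed simp

lemma power2_mod_4:
  fixes m :: int
  shows "m\<^sup>2 mod 4 = 0 \<or> m\<^sup>2 mod 4 = 1"
proof (cases "even m")
  case True
  then show ?thesis by (auto elim!: evenE)
next
  case False
  then show ?thesis using power2_cong_1_mod_4[of m] by (simp add: cong_def)
qed

theorem theorem3p1:
  fixes P Q :: int and n :: nat
  assumes "odd P" and "odd Q" and "odd n"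
    and "([n = 3] (mod 6) \<and> [Q = 3] (mod 4)) \<or> ([n = 5] (mod 6) \<and> [Q = 1] (mod 4))"
  shows "\<not> (\<exists>m::int. m \<noteq> 0 \<and> lucas_U P Q n = m\<^sup>2)"
proof -
  obtain k where n: "n = n mod 6 + 6 * k"
    by (metis mod_mult_div_eq)
  have red: "[lucas_U P Q n = lucas_U P Q (n mod 6)] (mod 4)"
    using lucas_U_add_6_mult_mod_4[OF assms(1,2)] n by metis
  have P2: "[P\<^sup>2 = 1] (mod 4)"
    using assms(1) by (rule power2_cong_1_mod_4)
  from assms(4) have "lucas_U P Q n mod 4 = 2 \<or> lucas_U P Q n mod 4 = 3"
  proof
    assume "[n = 3] (mod 6) \<and> [Q = 3] (mod 4)"
    then have n: "n mod 6 = 3" and Q: "[Q = 3] (mod 4)"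
      by (simp_all add: cong_def)
    \<comment> \<open>The value -2 is the residue 2.\<close>
    have "[P\<^sup>2 - Q = 1 - 3] (mod 4)"
      using P2 Q by (rule cong_diff)
    with red show ?thesis
      by (simp add: n lucas_U_3 cong_def)
  next
    assume "[n = 5] (mod 6) \<and> [Q = 1] (mod 4)"
    then have n: "n mod 6 = 5" and Q: "[Q = 1] (mod 4)"
      by (simp_all add: cong_def)
    \<comment> \<open>Writing \<open>P ^ 4\<close> as \<open>(P\<^sup>2)\<^sup>2\<close> lets
      \<open>P2\<close> apply to every power of \<open>P\<close>. The right-hand side is -1, the
      residue 3.\<close>
    have "[(P\<^sup>2)\<^sup>2 - 3 * P\<^sup>2 * Q + Q\<^sup>2 = 1\<^sup>2 - 3 * 1 * 1 + 1\<^sup>2] (mod 4)"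
      by (intro cong_add cong_diff cong_mult cong_pow P2 Q cong_refl)
    with red show ?thesis
      by (simp add: n lucas_U_5 cong_def)
  qed
  moreover have "lucas_U P Q n \<noteq> m\<^sup>2" if "lucas_U P Q n mod 4 = 2 \<or> lucas_U P Q n mod 4 = 3" for m
    using that power2_mod_4[of m] by auto
  ultimately show ?thesis
    by blast
qed

end
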